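(* Let $(C,d)$ be a complete metric cone. Let $X$ be a real or complex Banach space and let $T:C\to X$ be a continuous additive positively homogeneous map. Then the following are equivalent: (1) $T$ is surjective; (2) there exists some constant $K>0$ such that, for every $x\in X$, there exists some $c\in C$ with $x=Tc$ and $d(0,c)\leq K\|x\|$; (3) $T$ is an open map; (4) $0$ is an interior point of $T(C)$.
   Context: An abstract cone is a set $C$ with operations $+:C\times C\to C$ and $\cdot:\mathbb{R}_{\geq0}\times C\to C$ for which there exists an element $0\in C$ such that, for all $u,v,w\in C$ and $\lambda,\mu\in\mathbb{R}_{\geq0}$: (1) $u+0=u$; (2) $(u+v)+w=u+(w+v)$; (3) $u+v=v+u$; (4) $u+v=u+w$ implies $v=w$; (5) $1u=u$ and $0u=0$; (6) $(\lambda\mu)u=\lambda(\mu u)$; (7) $(\lambda+\mu)u=\lambda u+\mu u$; (8) $\lambda(u+v)=\lambda u+\lambda v$. A metric cone is a pair $(C,d)$ where $C$ is an abstract cone and $d:C\times C\to\mathbb{R}_{\geq0}$ is a metric satisfying $d(0,\lambda u)=\lambda d(0,u)$ and $d(u+v,u+w)\leq d(v,w)$ for all $u,v,w\in C$ and $\lambda\geq0$. It is a complete metric cone if it is a complete metric space. (For example, a closed, not necessarily proper, cone in a Banach space with the metric induced by the norm is a complete metric cone.) A map $T$ from $C$ to $X$ is additive if $T(u+v)=Tu+Tv$ and positively homogeneous if $T(\lambda u)=\lambda Tu$, for all $u,v\in C$ and real $\lambda\geq0$. An open map is one that maps open sets to open sets. *)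

theory Defs
  imports "HOL-Analysis.Analysis"
begin

(* Scalars are the nonnegative reals: scale is a function on all reals, but every law about it is
   guarded, so its values at negative scalars (and all operations outside C) are unconstrained.
   The neutral element is an explicit parameter; the laws determine it uniquely.
   The order of v and w on the right of cone_add_assoc is immaterial because of cone_add_commute. *)
locale abstract_cone =
  fixes C :: "'c set"
    and add :: "'c \<Rightarrow> 'c \<Rightarrow> 'c"  (infixl "\<oplus>" 65)
    and scale :: "real \<Rightarrow> 'c \<Rightarrow> 'c"  (infixr "\<odot>" 75)
    and zero :: 'c  ("\<zero>")
  assumes cone_add_closed: "\<lbrakk>u \<in> C; v \<in> C\<rbrakk> \<Longrightarrow> u \<oplus> v \<in> C"
    and cone_scale_closed: "\<lbrakk>0 \<le> l; u \<in> C\<rbrakk> \<Longrightarrow> l \<odot> u \<in> C"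
    and cone_zero_closed: "\<zero> \<in> C"
    and cone_add_zero: "u \<in> C \<Longrightarrow> u \<oplus> \<zero> = u"
    and cone_add_assoc: "\<lbrakk>u \<in> C; v \<in> C; w \<in> C\<rbrakk> \<Longrightarrow> (u \<oplus> v) \<oplus> w = u \<oplus> (w \<oplus> v)"
    and cone_add_commute: "\<lbrakk>u \<in> C; v \<in> C\<rbrakk> \<Longrightarrow> u \<oplus> v = v \<oplus> u"
    and cone_add_cancel: "\<lbrakk>u \<in> C; v \<in> C; w \<in> C; u \<oplus> v = u \<oplus> w\<rbrakk> \<Longrightarrow> v = w"
    and cone_scale_one: "u \<in> C \<Longrightarrow> 1 \<odot> u = u"
    and cone_scale_zero: "u \<in> C \<Longrightarrow> 0 \<odot> u = \<zero>"
    and cone_scale_assoc: "\<lbrakk>0 \<le> l; 0 \<le> m; u \<in> C\<rbrakk> \<Longrightarrow> (l * m) \<odot> u = l \<odot> (m \<odot> u)"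
    and cone_scale_add_left: "\<lbrakk>0 \<le> l; 0 \<le> m; u \<in> C\<rbrakk> \<Longrightarrow> (l + m) \<odot> u = l \<odot> u \<oplus> m \<odot> u"
    and cone_scale_add_right:
      "\<lbrakk>0 \<le> l; u \<in> C; v \<in> C\<rbrakk> \<Longrightarrow> l \<odot> (u \<oplus> v) = l \<odot> u \<oplus> l \<odot> v"

locale metric_cone = abstract_cone C add scale zero + Metric_space C d
  for C :: "'c set" and add (infixl "\<oplus>" 65) and scale (infixr "\<odot>" 75)
    and zero ("\<zero>") and d +
  assumes cone_dist_scale: "\<lbrakk>0 \<le> l; u \<in> C\<rbrakk> \<Longrightarrow> d \<zero> (l \<odot> u) = l * d \<zero> u"
    and cone_dist_add: "\<lbrakk>u \<in> C; v \<in> C; w \<in> C\<rbrakk> \<Longrightarrow> d (u \<oplus> v) (u \<oplus> w) \<le> d v w"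

locale complete_metric_cone = metric_cone +
  assumes cone_complete: mcomplete

end

theory Submission
  imports Defs
begin

text \<open>
  The argument follows the classical open mapping theorem; what has to be replaced is every
  appeal to negation and subtraction in the domain.

  If \<open>T\<close> is onto, Baire's theorem in \<open>X\<close> yields a bounded part of the cone whose image is dense in
  some ball \<open>ball y r\<close>. In a Banach space one would move the ball to the origin by subtracting
  a preimage of \<open>y\<close>. Here surjectivity helps instead: some \<open>b \<in> C\<close> has \<open>T b = - y\<close>, and
  \<^emph>\<open>adding\<close> \<open>b\<close> recentres the ball at \<open>0\<close> while enlarging the bound only by \<open>d 0 b\<close>
  (\<open>image_dense_in_ball_imp_approximable\<close>). Rescaling shows that every \<open>x\<close> is approximated
  arbitrarily well by images of points of size at most \<open>K * norm x\<close>.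

  Successive approximation then gives an exact preimage (\<open>approximable_imp_bounded_preimage\<close>). The
  partial sums only ever add elements of the cone; the remainders, which do need subtraction, live
  in \<open>X\<close>. Adding \<open>c\<close> moves a point by at most \<open>d 0 c\<close>, because translations do not increase
  distances; hence the partial sums form a Cauchy sequence, and the cone is complete.

  The same estimate turns linearly bounded preimages into openness: a point near \<open>T u\<close> is
  \<open>T (u + c)\<close> with \<open>c\<close> small. Openness makes \<open>0\<close> an interior point of the image, and
  since the image is closed under nonnegative scaling, it is then all of \<open>X\<close>.
\<close>

section \<open>Size of cone elements\<close>

context metric_cone
begin

lemma dist_add_right_le:
  assumes "u \<in> C" "c \<in> C"
  shows "d u (u \<oplus> c) \<le> d \<zero> c"
  using cone_dist_add[of u \<zero> c] assms cone_zero_closed cone_add_zero by simp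

lemma dist_zero_add_le:
  assumes "u \<in> C" "c \<in> C"
  shows "d \<zero> (u \<oplus> c) \<le> d \<zero> u + d \<zero> c"
  using triangle[of \<zero> u "u \<oplus> c"] dist_add_right_le[OF assms] assms
    cone_zero_closed cone_add_closed by fastforce

end

text \<open>
  The subtracted term is the tail of the geometric series from index \<open>n\<close> on; with it the bound is an
  exact partial sum, which is what lets the induction on \<open>n\<close> close.
\<close>

lemma (in Metric_space) geometric_steps_dist_le:
  assumes u: "\<And>n. u n \<in> M" and step: "\<And>n. d (u n) (u (Suc n)) \<le> a / 2 ^ n"
    and "m \<le> n"
  shows "d (u m) (u n) \<le> 2 * a / 2 ^ m - 2 * a / 2 ^ n"
  using \<open>m \<le> n\<close>
proof (induction n rule: dec_induct)
  case base
  then show ?case using u by simp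
next
  case (step k)
  have "d (u m) (u (Suc k)) \<le> d (u m) (u k) + d (u k) (u (Suc k))"
    using triangle u by blast
  moreover have "2 * a / 2 ^ k = a / 2 ^ k + a / 2 ^ k" "2 * a / 2 ^ Suc k = a / 2 ^ k"
    by simp_all
  ultimately show ?case using step.IH assms(2)[of k] by linarith
qed

lemma (in Metric_space) geometric_steps_convergent:
  assumes "mcomplete" and u: "\<And>n. u n \<in> M" and "0 \<le> a"
    and step: "\<And>n. d (u n) (u (Suc n)) \<le> a / 2 ^ n"
  obtains l where "limitin mtopology u l sequentially" "l \<in> M" "d (u 0) l \<le> 2 * a"
proof -
  have dist_le: "d (u m) (u n) \<le> 2 * a / 2 ^ m" if "m \<le> n" for m n
  proof -
    have "0 \<le> 2 * a / 2 ^ n" using \<open>0 \<le> a\<close> by simp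
    with geometric_steps_dist_le[OF u step that] show ?thesis by linarith
  qed
  have "MCauchy u"
    unfolding MCauchy_def
  proof (intro conjI allI impI)
    show "range u \<subseteq> M" using u by blast
    fix e :: real assume "0 < e"
    have "(\<lambda>n. 2 * a * (1 / 2) ^ n) \<longlonglongrightarrow> 2 * a * 0"
      by (intro tendsto_mult tendsto_const LIMSEQ_power_zero) simp
    then have "\<forall>\<^sub>F n in sequentially. 2 * a * (1 / 2) ^ n < e"
      using \<open>0 < e\<close> by (auto dest: order_tendstoD(2))
    then obtain N where N: "\<And>n. N \<le> n \<Longrightarrow> 2 * a / 2 ^ n < e"
      by (auto simp: eventually_sequentially power_one_over)
    have "d (u n) (u n') < e" if "N \<le> n" "n \<le> n'" for n n'
      using dist_le[OF that(2)] N[OF that(1)] by linarith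
    then have "d (u n) (u n') < e" if "N \<le> n" "N \<le> n'" for n n'
      using that commute by (metis nle_le)
    then show "\<exists>N. \<forall>n n'. N \<le> n \<longrightarrow> N \<le> n' \<longrightarrow> d (u n) (u n') < e" by blast
  qed
  then obtain l where l: "limitin mtopology u l sequentially"
    using \<open>mcomplete\<close> mcomplete_def by blast
  have "l \<in> mcball (u 0) (2 * a)"
  proof (rule limitin_closedin[OF l closedin_mcball])
    show "\<forall>\<^sub>F n in sequentially. u n \<in> mcball (u 0) (2 * a)"
      using u dist_le[of 0] by simp
  qed simp
  then show thesis using that l by simp
qed

section \<open>Continuous additive positively homogeneous maps\<close>

locale cone_map = metric_cone C add scale zero d
  for C :: "'c set" and add (infixl "\<oplus>" 65) and scale (infixr "\<odot>" 75)
    and zero ("\<zero>") and d +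
  fixes T :: "'c \<Rightarrow> 'x::real_normed_vector"
  assumes continuous: "continuous_map mtopology euclidean T"
    and additive: "\<lbrakk>u \<in> C; v \<in> C\<rbrakk> \<Longrightarrow> T (u \<oplus> v) = T u + T v"
    and homogeneous: "\<lbrakk>0 \<le> l; u \<in> C\<rbrakk> \<Longrightarrow> T (l \<odot> u) = l *\<^sub>R T u"
begin

lemma map_zero: "T \<zero> = 0"
  using homogeneous[of 0 \<zero>] cone_scale_zero cone_zero_closed by simp

text \<open>
  Successive approximation. The partial sums \<open>u n\<close> leave a remainder \<open>x - T (u n)\<close> of norm at
  most \<open>norm x / 2 ^ n\<close>, and each new summand has size at most \<open>K\<close> times the
  norm of the current remainder.
  The halving rate makes the total size at most twice the bound on the first summand.
\<close>

lemma approximable_imp_bounded_preimage: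
  assumes "mcomplete" and "0 \<le> K"
    and approx: "\<And>x e. 0 < e \<Longrightarrow> \<exists>c\<in>C. d \<zero> c \<le> K * norm x \<and> norm (x - T c) < e"
  shows "\<exists>c\<in>C. x = T c \<and> d \<zero> c \<le> 2 * K * norm x"
proof (cases "x = 0")
  case True
  then show ?thesis using map_zero cone_zero_closed by force
next
  case False
  let ?P = "\<lambda>n u. u \<in> C \<and> norm (x - T u) \<le> norm x / 2 ^ n \<and> (n = 0 \<longrightarrow> u = \<zero>)"
  let ?Q = "\<lambda>n u v. d u v \<le> K * norm x / 2 ^ n"
  have "\<exists>u. \<forall>n. ?P n (u n) \<and> ?Q n (u n) (u (Suc n))"
  proof (rule dependent_nat_choice)
    show "\<exists>u. ?P 0 u" using map_zero cone_zero_closed by auto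
  next
    fix u n assume u: "?P n u"
    obtain c where c: "c \<in> C" "d \<zero> c \<le> K * norm (x - T u)"
        "norm ((x - T u) - T c) < norm x / 2 ^ Suc n"
      using approx[of "norm x / 2 ^ Suc n" "x - T u"] False by auto
    have "K * norm (x - T u) \<le> K * (norm x / 2 ^ n)"
      using u \<open>0 \<le> K\<close> by (intro mult_left_mono) auto
    then have "d u (u \<oplus> c) \<le> K * norm x / 2 ^ n"
      using dist_add_right_le[of u c] u c by simp
    moreover have "norm (x - T (u \<oplus> c)) \<le> norm x / 2 ^ Suc n"
      using c additive[of u c] u by (simp add: algebra_simps)
    ultimately show "\<exists>v. ?P (Suc n) v \<and> ?Q n u v"
      using u c cone_add_closed by blast
  qed
  then obtain u where u: "\<And>n. ?P n (u n)" "\<And>n. ?Q n (u n) (u (Suc n))" by blast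
  have "0 \<le> K * norm x" using \<open>0 \<le> K\<close> by simp
  then obtain l where l: "limitin mtopology u l sequentially" "l \<in> C"
      "d (u 0) l \<le> 2 * (K * norm x)"
    using geometric_steps_convergent[OF \<open>mcomplete\<close>, of u "K * norm x"] u by blast
  have "(\<lambda>n. T (u n)) \<longlonglongrightarrow> T l"
    using continuous_map_limit[OF continuous l(1)] by (simp add: o_def)
  moreover have "(\<lambda>n. T (u n)) \<longlonglongrightarrow> x"
  proof -
    have "(\<lambda>n. norm x * (1 / 2) ^ n) \<longlonglongrightarrow> norm x * 0"
      by (intro tendsto_mult tendsto_const LIMSEQ_power_zero) simp
    then have "(\<lambda>n. norm x / 2 ^ n) \<longlonglongrightarrow> 0" by (simp add: power_one_over)
    moreover have "norm (T (u n) - x) \<le> norm x / 2 ^ n" for n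
      using u(1)[of n] norm_minus_commute[of x "T (u n)"] by linarith
    then have "\<forall>\<^sub>F n in sequentially. norm (T (u n) - x) \<le> norm x / 2 ^ n"
      by (rule always_eventually[OF allI])
    ultimately have "(\<lambda>n. T (u n) - x) \<longlonglongrightarrow> 0" by (rule Lim_null_comparison[rotated])
    then show ?thesis by (simp add: LIM_zero_iff)
  qed
  ultimately have "x = T l" using LIMSEQ_unique by blast
  moreover have "u 0 = \<zero>" using u(1)[of 0] by simp
  ultimately show ?thesis using l by (auto simp: mult.assoc)
qed

text \<open>
  Baire's theorem, applied to the closures of the images of the balls about \<open>0\<close> with integer
  radius: a complete normed space is not a countable union of closed sets with empty interior.
\<close>

lemma surj_imp_image_dense_in_ball:
  assumes "complete (UNIV :: 'x set)" and surj: "T ` C = UNIV"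
  obtains y r R where "0 < r" "ball y r \<subseteq> closure (T ` {c \<in> C. d \<zero> c \<le> R})"
proof -
  let ?B = "\<lambda>n::nat. {c \<in> C. d \<zero> c \<le> real n}"
  let ?F = "range (\<lambda>n. closure (T ` ?B n))"
  have "x \<in> \<Union>?F" for x
  proof -
    have "x \<in> T ` C" using surj by simp
    then obtain c where c: "c \<in> C" "x = T c" by blast
    obtain n where "d \<zero> c \<le> real n" using real_arch_simple by blast
    then have "x \<in> T ` ?B n" using c by blast
    then have "x \<in> closure (T ` ?B n)" by (rule subsetD[OF closure_subset])
    then show ?thesis by blast
  qed
  then have "\<Union>?F = UNIV" by blast
  then have nonempty: "Met_TC.mtopology interior_of \<Union>?F \<noteq> {}" by simp
  have complete: "Met_TC.mcomplete TYPE('x)" using assms(1) by simp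
  have "\<exists>n. interior (closure (T ` ?B n)) \<noteq> {}"
  proof (rule ccontr)
    assume "\<not> ?thesis"
    then have empty: "interior (closure (T ` ?B n)) = {}" for n by blast
    have "closedin Met_TC.mtopology G \<and> Met_TC.mtopology interior_of G = {}" if "G \<in> ?F" for G
    proof -
      from that obtain n where "G = closure (T ` ?B n)" by blast
      with empty[of n] show ?thesis by simp
    qed
    then have "Met_TC.mtopology interior_of \<Union>?F = {}"
      by (intro Met_TC.metric_Baire_category_alt complete countable_image countableI_type)
    with nonempty show False by contradiction
  qed
  then obtain n where "interior (closure (T ` ?B n)) \<noteq> {}" by blast
  then obtain y where "y \<in> interior (closure (T ` ?B n))" by blast
  then obtain r where "0 < r" "ball y r \<subseteq> closure (T ` ?B n)"
    by (auto simp: mem_interior)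
  then show thesis using that by blast
qed

text \<open>
  Given \<open>x \<noteq> 0\<close>, the multiple \<open>(r / (2 * norm x)) *\<^sub>R x\<close> has norm \<open>r / 2\<close>, so its translate by \<open>y\<close>
  lies in the ball and is almost attained, by \<open>T a\<close> say. With \<open>T b = - y\<close>, the point \<open>a + b\<close>
  almost attains the multiple itself, and scaling back multiplies its size, at most
  \<open>R + d 0 b\<close>, by \<open>2 * norm x / r\<close>.
\<close>

lemma image_dense_in_ball_imp_approximable:
  assumes "0 < r" and dense: "ball y r \<subseteq> closure (T ` {c \<in> C. d \<zero> c \<le> R})"
    and b: "b \<in> C" "T b = - y" and "0 < e"
  shows "\<exists>c\<in>C. d \<zero> c \<le> 2 * (R + d \<zero> b) / r * norm x \<and> norm (x - T c) < e"
proof (cases "x = 0")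
  case True
  then show ?thesis using map_zero cone_zero_closed \<open>0 < e\<close> by force
next
  case False
  define s where "s = 2 * norm x / r"
  have "0 < s" using False \<open>0 < r\<close> by (simp add: s_def)
  have "norm ((1 / s) *\<^sub>R x) < r" using False \<open>0 < r\<close> by (simp add: s_def)
  then have "y + (1 / s) *\<^sub>R x \<in> ball y r" by (simp add: dist_norm)
  then have "y + (1 / s) *\<^sub>R x \<in> closure (T ` {c \<in> C. d \<zero> c \<le> R})" using dense by blast
  moreover have "0 < e / s" using \<open>0 < e\<close> \<open>0 < s\<close> by simp
  ultimately obtain a where a: "a \<in> C" "d \<zero> a \<le> R" "dist (T a) (y + (1 / s) *\<^sub>R x) < e / s"
    unfolding closure_approachable by blast
  have ab: "a \<oplus> b \<in> C" using a b cone_add_closed by blast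
  show ?thesis
  proof (intro bexI conjI)
    show "s \<odot> (a \<oplus> b) \<in> C" using ab \<open>0 < s\<close> cone_scale_closed by simp
    have "d \<zero> (s \<odot> (a \<oplus> b)) = s * d \<zero> (a \<oplus> b)"
      using cone_dist_scale ab \<open>0 < s\<close> by simp
    also have "\<dots> \<le> s * (R + d \<zero> b)"
      using dist_zero_add_le[of a b] a b \<open>0 < s\<close> by (intro mult_left_mono) auto
    finally show "d \<zero> (s \<odot> (a \<oplus> b)) \<le> 2 * (R + d \<zero> b) / r * norm x"
      by (simp add: s_def mult_ac)
    have "x - T (s \<odot> (a \<oplus> b)) = s *\<^sub>R ((y + (1 / s) *\<^sub>R x) - T a)"
      using homogeneous[OF _ ab, of s] additive a b \<open>0 < s\<close> by (simp add: algebra_simps)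
    then have "norm (x - T (s \<odot> (a \<oplus> b))) = s * dist (T a) (y + (1 / s) *\<^sub>R x)"
      using \<open>0 < s\<close> by (simp add: dist_norm norm_minus_commute)
    also have "\<dots> < e" using a(3) \<open>0 < s\<close> by (simp add: field_simps)
    finally show "norm (x - T (s \<odot> (a \<oplus> b))) < e" .
  qed
qed

lemma surj_imp_bounded_preimage:
  assumes "mcomplete" and "complete (UNIV :: 'x set)" and surj: "T ` C = UNIV"
  shows "\<exists>K>0. \<forall>x. \<exists>c\<in>C. x = T c \<and> d \<zero> c \<le> K * norm x"
proof -
  obtain y r R where yr: "0 < r" "ball y r \<subseteq> closure (T ` {c \<in> C. d \<zero> c \<le> R})"
    by (rule surj_imp_image_dense_in_ball[OF assms(2,3)])
  have "- y \<in> T ` C" using surj by simp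
  then obtain b where b: "b \<in> C" "T b = - y" by force
  \<comment> \<open>Replacing \<open>R\<close> by \<open>max R 1\<close> keeps density and makes the resulting constant positive.\<close>
  have "{c \<in> C. d \<zero> c \<le> R} \<subseteq> {c \<in> C. d \<zero> c \<le> max R 1}" by auto
  then have dense: "ball y r \<subseteq> closure (T ` {c \<in> C. d \<zero> c \<le> max R 1})"
    using yr(2) by (meson closure_mono image_mono order_trans)
  define K where "K = 2 * (max R 1 + d \<zero> b) / r"
  have "0 < max R 1 + d \<zero> b" using nonneg[of \<zero> b] by linarith
  then have "0 < K" using yr(1) by (simp add: K_def)
  have "\<exists>c\<in>C. x = T c \<and> d \<zero> c \<le> 2 * K * norm x" for x
  proof (rule approximable_imp_bounded_preimage[OF \<open>mcomplete\<close>])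
    show "0 \<le> K" using \<open>0 < K\<close> by simp
    show "\<exists>c\<in>C. d \<zero> c \<le> K * norm z \<and> norm (z - T c) < e" if "0 < e" for z e
      unfolding K_def by (rule image_dense_in_ball_imp_approximable[OF yr(1) dense b that])
  qed
  moreover have "0 < 2 * K" using \<open>0 < K\<close> by simp
  ultimately show ?thesis by blast
qed

lemma bounded_preimage_imp_open_map:
  assumes "0 < K" and K: "\<And>x. \<exists>c\<in>C. x = T c \<and> d \<zero> c \<le> K * norm x"
  shows "open_map mtopology euclidean T"
  unfolding open_map_def
proof (intro allI impI)
  fix U assume U: "openin mtopology U"
  have "\<exists>e>0. ball x e \<subseteq> T ` U" if "x \<in> T ` U" for x
  proof -
    from that obtain u where u: "u \<in> U" "x = T u" by blast
    with U obtain r where r: "0 < r" "mball u r \<subseteq> U" "u \<in> C"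
      unfolding openin_mtopology by blast
    have "z \<in> T ` U" if "z \<in> ball x (r / K)" for z
    proof -
      obtain c where c: "c \<in> C" "z - x = T c" "d \<zero> c \<le> K * norm (z - x)" using K by blast
      have "K * norm (z - x) < r"
        using that \<open>0 < K\<close> by (simp add: dist_norm norm_minus_commute field_simps)
      then have "u \<oplus> c \<in> mball u r"
        using dist_add_right_le[of u c] c r cone_add_closed by simp
      moreover have "T (u \<oplus> c) = z" using additive[OF r(3) c(1)] u(2) c(2) by (simp add: algebra_simps)
      ultimately show ?thesis using r by blast
    qed
    then show ?thesis using \<open>0 < r\<close> \<open>0 < K\<close> by (intro exI[of _ "r / K"]) auto
  qed
  then show "openin euclidean (T ` U)" by (simp add: open_contains_ball)
qed

lemma open_map_imp_zero_interior:
  assumes "open_map mtopology euclidean T"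
  shows "0 \<in> interior (T ` C)"
proof -
  have "open (T ` C)"
    using assms openin_topspace[of mtopology] unfolding open_map_def by simp
  moreover have "0 \<in> T ` C" using map_zero cone_zero_closed by force
  ultimately show ?thesis by (simp add: interior_open)
qed

lemma zero_interior_imp_surj:
  assumes "0 \<in> interior (T ` C)"
  shows "T ` C = UNIV"
proof -
  obtain r where r: "0 < r" "ball 0 r \<subseteq> T ` C" using assms by (auto simp: mem_interior)
  have "x \<in> T ` C" for x
  proof (cases "x = 0")
    case True
    then show ?thesis using map_zero cone_zero_closed by force
  next
    case False
    define s where "s = 2 * norm x / r"
    have "0 < s" using False r by (simp add: s_def)
    have "(1 / s) *\<^sub>R x \<in> ball 0 r" using False r by (simp add: s_def)
    then obtain c where c: "c \<in> C" "T c = (1 / s) *\<^sub>R x" using r by (metis imageE subsetD)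
    then have "T (s \<odot> c) = x" using homogeneous \<open>0 < s\<close> by simp
    then show ?thesis using cone_scale_closed c \<open>0 < s\<close> by (metis imageI less_imp_le)
  qed
  then show ?thesis by blast
qed

end

section \<open>The open mapping theorem for complete metric cones\<close>

theorem theorem3p2:
  fixes C :: "'c set" and add :: "'c \<Rightarrow> 'c \<Rightarrow> 'c" and scale :: "real \<Rightarrow> 'c \<Rightarrow> 'c"
    and zero :: 'c and d :: "'c \<Rightarrow> 'c \<Rightarrow> real"
    and T :: "'c \<Rightarrow> 'x::banach"
  assumes cone: "complete_metric_cone C add scale zero d"
    and continuous: "continuous_map (Metric_space.mtopology C d) euclidean T"
    and additive: "\<And>u v. u \<in> C \<Longrightarrow> v \<in> C \<Longrightarrow> T (add u v) = T u + T v"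
    and homogeneous: "\<And>l u. 0 \<le> l \<Longrightarrow> u \<in> C \<Longrightarrow> T (scale l u) = l *\<^sub>R T u"
  shows "((T ` C = UNIV) \<longleftrightarrow> (\<exists>K>0. \<forall>x. \<exists>c\<in>C. x = T c \<and> d zero c \<le> K * norm x))
    \<and> ((\<exists>K>0. \<forall>x. \<exists>c\<in>C. x = T c \<and> d zero c \<le> K * norm x)
          \<longleftrightarrow> open_map (Metric_space.mtopology C d) euclidean T)
    \<and> (open_map (Metric_space.mtopology C d) euclidean T \<longleftrightarrow> 0 \<in> interior (T ` C))"
proof -
  interpret complete_metric_cone C add scale zero d by (rule cone)
  interpret cone_map C add scale zero d T
    by unfold_locales (use continuous additive homogeneous in auto)
  have "complete (UNIV :: 'x set)" by (simp add: complete_UNIV)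
  then show ?thesis
    using surj_imp_bounded_preimage[OF cone_complete] bounded_preimage_imp_open_map
      open_map_imp_zero_interior zero_interior_imp_surj by blast
qed

end
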